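(* For every positive integer $k$, there exist two non-isomorphic pure clique complexes with the same intersection data up to degree $k$. That is, there exist an integer $q\ge k$ and two non-isomorphic pure clique complexes $K$ and $K'$, with labeled facets $F_1,\dots,F_q$ and $F'_1,\dots,F'_q$ respectively, such that for every $1\le j\le k$ and every $j$-element subset $\{i_1,\dots,i_j\}\subseteq\{1,\dots,q\}$, $$|F_{i_1}\cap\cdots\cap F_{i_j}|=|F'_{i_1}\cap\cdots\cap F'_{i_j}|.$$
   Context: A finite abstract simplicial complex is a collection of subsets (faces) of a finite base set closed under taking subsets; facets are its inclusion-maximal faces, and the base set is the union of the facets. A complex is pure if all of its facets have the same cardinality. A clique complex is a simplicial complex whose faces are exactly the cliques of some finite simple graph on its vertex set. The intersection data of degree $j$ of a complex with labeled (distinct) facets is the labeled family of the numbers $|F_{i_1}\cap\cdots\cap F_{i_j}|$ over all choices of $j$ distinct facets. Two simplicial complexes are isomorphic if there is a bijection of their vertex sets inducing a bijection between their faces. *)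

theory Defs
  imports "HOL-Library.Ramsey"
begin

text \<open>A complex is represented by its set of faces. The base set is the union of the faces, which
  for a finite complex is also the union of the facets.\<close>

definition simplicial_complex :: "'a set set \<Rightarrow> bool" where
  "simplicial_complex K \<longleftrightarrow> finite (\<Union>K) \<and> (\<forall>F\<in>K. \<forall>G. G \<subseteq> F \<longrightarrow> G \<in> K)"

definition facets :: "'a set set \<Rightarrow> 'a set set" where
  "facets K = {F \<in> K. \<forall>G\<in>K. F \<subseteq> G \<longrightarrow> F = G}"

definition pure_complex :: "'a set set \<Rightarrow> bool" where
  "pure_complex K \<longleftrightarrow> simplicial_complex K \<and> (\<forall>F\<in>facets K. \<forall>G\<in>facets K. card F = card G)"

text \<open>The edge set \<open>E\<close> of a simple graph on \<open>V\<close> consists of two-element subsets of \<open>V\<close>;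
  the empty set and all singletons are cliques.\<close>

definition clique_complex :: "'a set set \<Rightarrow> bool" where
  "clique_complex K \<longleftrightarrow> simplicial_complex K \<and>
     (\<exists>E. E \<subseteq> [\<Union>K]\<^bsup>2\<^esup> \<and> K = {C. C \<subseteq> \<Union>K \<and> clique C E})"

definition complex_iso :: "'a set set \<Rightarrow> 'b set set \<Rightarrow> bool" where
  "complex_iso K L \<longleftrightarrow> (\<exists>f. bij_betw f (\<Union>K) (\<Union>L) \<and> bij_betw (image f) K L)"

text \<open>\<open>F\<close> labels the facets of \<open>K\<close> by \<open>1, \<dots>, q\<close>, each facet exactly once.\<close>

definition facet_labeling :: "'a set set \<Rightarrow> nat \<Rightarrow> (nat \<Rightarrow> 'a set) \<Rightarrow> bool" where
  "facet_labeling K q F \<longleftrightarrow> bij_betw F {1..q} (facets K)"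

text \<open>Only the values at \<open>j\<close>-element subsets of the label set belong to the family, which is
  therefore \<^const>\<open>undefined\<close> elsewhere.\<close>

definition intersection_data :: "nat \<Rightarrow> (nat \<Rightarrow> 'a set) \<Rightarrow> nat \<Rightarrow> nat set \<Rightarrow> nat" where
  "intersection_data q F j = (\<lambda>I\<in>{I. I \<subseteq> {1..q} \<and> card I = j}. card (\<Inter>i\<in>I. F i))"

end

theory Submission
  imports Defs "HOL-Library.Nat_Bijection"
begin

text \<open>
  Write \<open>n = 2 * k\<close> and let \<open>\<T>\<close> be a family of subsets of \<open>{1..n}\<close>. The complex built from \<open>\<T>\<close> has a
  central facet, labeled \<open>n + 1\<close>, with one vertex for each \<open>T \<in> \<T>\<close>, and a facet for each \<open>i \<in> {1..n}\<close>
  in which the central vertex of \<open>T\<close> is kept if \<open>i \<in> T\<close> and replaced by a vertex private to \<open>i\<close> if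
  \<open>i \<notin> T\<close>. Every facet thus has exactly one vertex for each \<open>T \<in> \<T>\<close>, so the complex is pure. Any two
  facets meet inside the central one, that is, the facets form a star; for this reason the complex
  is a clique complex: a clique with a private vertex lies in the only facet containing that
  vertex, and every other clique lies in the central facet.

  Take for \<open>\<T>\<close> the subsets of even cardinality in one complex, and those of odd cardinality in the
  other. If \<open>I\<close> is a nonempty set of at most \<open>k\<close> labels, then some \<open>a \<in> {1..n}\<close> lies outside \<open>I\<close>, and adding \<open>a\<close>
  to \<open>T\<close> or removing it changes the parity but none of the incidences with the facets in \<open>I\<close>. This
  matches the intersections over \<open>I\<close> in the two complexes (\<open>card_Inter_eq\<close>). On the other hand,
  a vertex common to all facets must be the central vertex of the full set \<open>{1..n}\<close>, which is present
  in the even complex only, since \<open>n\<close> is even. Having such a cone point is invariant under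
  isomorphism (\<open>complex_iso_cone_point\<close>), so the complexes are not isomorphic.
\<close>

section \<open>The star complex of a set family\<close>

text \<open>Vertices are coded as natural numbers; the coding is injective only for finite sets.\<close>

definition vertex :: "nat \<Rightarrow> nat set \<Rightarrow> nat" where
  "vertex j T = prod_encode (j, set_encode T)"

definition star_facet :: "nat \<Rightarrow> nat set set \<Rightarrow> nat \<Rightarrow> nat set" where
  "star_facet n \<T> i = (\<lambda>T. vertex (if i \<in> T then Suc n else i) T) ` \<T>"

definition star_complex :: "nat \<Rightarrow> nat set set \<Rightarrow> nat set set" where
  "star_complex n \<T> = {C. \<exists>i\<in>{1..Suc n}. C \<subseteq> star_facet n \<T> i}"

lemma vertex_eq_iff:
  assumes "finite T" "finite T'"
  shows "vertex j T = vertex j' T' \<longleftrightarrow> j = j' \<and> T = T'"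
  using assms by (auto simp: vertex_def set_encode_eq)

text \<open>The second assumption says that each of the facets \<open>1, \<dots>, n\<close> has a private vertex; it keeps
  the facets distinct.\<close>

locale star_family =
  fixes n :: nat and \<T> :: "nat set set"
  assumes subsets: "\<T> \<subseteq> Pow {1..n}"
    and avoid: "\<And>i. i \<in> {1..n} \<Longrightarrow> \<exists>T\<in>\<T>. i \<notin> T"
begin

lemma finite_member: "T \<in> \<T> \<Longrightarrow> finite T"
  using subsets finite_subset[of T "{1..n}"] by blast

lemma finite_family: "finite \<T>"
  using subsets finite_subset[of \<T> "Pow {1..n}"] by blast

lemma center_notin: "T \<in> \<T> \<Longrightarrow> Suc n \<notin> T"
  using subsets by fastforce

lemma vertex_in_star_facet:
  assumes "T \<in> \<T>"
  shows "vertex j T \<in> star_facet n \<T> i \<longleftrightarrow> j = (if i \<in> T then Suc n else i)"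
proof
  assume "vertex j T \<in> star_facet n \<T> i"
  then obtain T' where "T' \<in> \<T>" "vertex j T = vertex (if i \<in> T' then Suc n else i) T'"
    unfolding star_facet_def by blast
  then show "j = (if i \<in> T then Suc n else i)"
    using vertex_eq_iff[OF finite_member finite_member] assms by metis
next
  assume "j = (if i \<in> T then Suc n else i)"
  then show "vertex j T \<in> star_facet n \<T> i"
    using assms unfolding star_facet_def by blast
qed

lemma star_facetE:
  assumes "x \<in> star_facet n \<T> i"
  obtains j T where "x = vertex j T" "T \<in> \<T>"
  using assms unfolding star_facet_def by blast

lemma inj_on_vertices: "inj_on (\<lambda>T. vertex (f T) T) \<T>"
  by (rule inj_onI) (use vertex_eq_iff finite_member in blast)

lemma card_star_facet: "card (star_facet n \<T> i) = card \<T>"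
  unfolding star_facet_def by (rule card_image) (rule inj_on_vertices)

lemma finite_star_facet: "finite (star_facet n \<T> i)"
  unfolding star_facet_def using finite_family by simp

lemma private_vertex:
  assumes "T \<in> \<T>" "j \<noteq> Suc n" "vertex j T \<in> star_facet n \<T> i"
  shows "i = j"
  using assms by (auto simp: vertex_in_star_facet split: if_splits)

lemma star_facet_neq:
  assumes "i \<in> {1..n}" "i' \<noteq> i"
  shows "star_facet n \<T> i \<noteq> star_facet n \<T> i'"
proof -
  obtain T where T: "T \<in> \<T>" "i \<notin> T"
    using avoid assms(1) by blast
  have "vertex i T \<in> star_facet n \<T> i"
    using T by (simp add: vertex_in_star_facet)
  moreover have "vertex i T \<notin> star_facet n \<T> i'"
    using private_vertex[OF T(1)] assms by fastforce
  ultimately show ?thesis by blast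
qed

lemma inj_on_star_facet: "inj_on (star_facet n \<T>) {1..Suc n}"
proof (rule inj_onI, rule ccontr)
  fix i i' assume *: "i \<in> {1..Suc n}" "i' \<in> {1..Suc n}" "star_facet n \<T> i = star_facet n \<T> i'" "i \<noteq> i'"
  \<comment> \<open>At most one of the two labels is the central one.\<close>
  then have "i \<in> {1..n} \<or> i' \<in> {1..n}" by auto
  then show False using star_facet_neq * by metis
qed

text \<open>The facets have equal finite cardinality, so for them inclusion is equality.\<close>

lemma star_facet_subset:
  assumes "i \<in> {1..Suc n}" "i' \<in> {1..Suc n}" "star_facet n \<T> i \<subseteq> star_facet n \<T> i'"
  shows "i = i'"
proof -
  have "star_facet n \<T> i = star_facet n \<T> i'"
    using assms(3) by (intro card_subset_eq finite_star_facet) (simp_all add: card_star_facet)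
  then show ?thesis
    using inj_on_star_facet assms by (meson inj_onD)
qed

lemma facets_star_complex: "facets (star_complex n \<T>) = star_facet n \<T> ` {1..Suc n}"
proof (intro set_eqI iffI)
  fix A assume A: "A \<in> facets (star_complex n \<T>)"
  then obtain i where i: "i \<in> {1..Suc n}" "A \<subseteq> star_facet n \<T> i"
    unfolding facets_def star_complex_def by blast
  moreover have "star_facet n \<T> i \<in> star_complex n \<T>"
    using i unfolding star_complex_def by blast
  ultimately have "A = star_facet n \<T> i"
    using A unfolding facets_def by blast
  then show "A \<in> star_facet n \<T> ` {1..Suc n}" using i by blast
next
  fix A assume "A \<in> star_facet n \<T> ` {1..Suc n}"
  then obtain i where i: "i \<in> {1..Suc n}" "A = star_facet n \<T> i" by blast
  have "A = G" if G: "G \<in> star_complex n \<T>" "A \<subseteq> G" for G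
  proof -
    obtain i' where i': "i' \<in> {1..Suc n}" "G \<subseteq> star_facet n \<T> i'"
      using G unfolding star_complex_def by blast
    then have "i = i'"
      using star_facet_subset i G by blast
    then show ?thesis using i i' G by blast
  qed
  then show "A \<in> facets (star_complex n \<T>)"
    using i unfolding facets_def star_complex_def by blast
qed

lemma facet_labeling_star: "facet_labeling (star_complex n \<T>) (Suc n) (star_facet n \<T>)"
  unfolding facet_labeling_def facets_star_complex
  using inj_on_star_facet by (simp add: bij_betw_def)

lemma Union_star_complex: "\<Union>(star_complex n \<T>) = (\<Union>i\<in>{1..Suc n}. star_facet n \<T> i)"
  unfolding star_complex_def by blast

lemma simplicial_star_complex: "simplicial_complex (star_complex n \<T>)"
  unfolding simplicial_complex_def Union_star_complex
  using finite_star_facet by (auto simp: star_complex_def)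

lemma pure_star_complex: "pure_complex (star_complex n \<T>)"
  unfolding pure_complex_def
  using simplicial_star_complex by (auto simp: facets_star_complex card_star_facet)

lemma clique_star_complex: "clique_complex (star_complex n \<T>)"
proof -
  let ?K = "star_complex n \<T>"
  define E where "E = {e \<in> ?K. card e = 2}"
  have "E \<subseteq> [\<Union>?K]\<^bsup>2\<^esup>"
    unfolding E_def nsets_def using card.infinite by fastforce
  moreover have "C \<subseteq> \<Union>?K \<and> clique C E" if C: "C \<in> ?K" for C
  proof -
    have "{v, w} \<in> E" if vw: "v \<in> C" "w \<in> C" "v \<noteq> w" for v w
    proof -
      have "{v, w} \<in> ?K"
        using simplicial_star_complex C vw unfolding simplicial_complex_def by simp
      then show ?thesis using vw(3) unfolding E_def by simp
    qed
    then show ?thesis using C unfolding clique_def by (intro conjI Union_upper) auto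
  qed
  moreover have "C \<in> ?K" if C: "C \<subseteq> \<Union>?K" "clique C E" for C
  proof -
    have vertices: "\<exists>j T. x = vertex j T \<and> T \<in> \<T>" if x: "x \<in> C" for x
    proof -
      obtain i where "x \<in> star_facet n \<T> i"
        using x C unfolding Union_star_complex by blast
      then show ?thesis by (rule star_facetE) blast
    qed
    show ?thesis
    proof (cases "\<exists>j T. j \<noteq> Suc n \<and> T \<in> \<T> \<and> vertex j T \<in> C")
      case True
      then obtain j T where jT: "j \<noteq> Suc n" "T \<in> \<T>" "vertex j T \<in> C" by blast
      have only: "i = j" if "vertex j T \<in> star_facet n \<T> i" for i
        using private_vertex jT that by blast
      obtain i where "i \<in> {1..Suc n}" "vertex j T \<in> star_facet n \<T> i"
        using jT(3) C(1) unfolding Union_star_complex by (meson UN_E subsetD)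
      then have j: "j \<in> {1..Suc n} \<and> vertex j T \<in> star_facet n \<T> j"
        using only by metis
      have "w \<in> star_facet n \<T> j" if "w \<in> C" for w
      proof (cases "w = vertex j T")
        case False
        then have "{vertex j T, w} \<in> E"
          using C(2) jT(3) that unfolding clique_def by metis
        then obtain i where "{vertex j T, w} \<subseteq> star_facet n \<T> i"
          unfolding E_def star_complex_def by blast
        then show ?thesis
          using only by auto
      qed (use j in simp)
      then show ?thesis
        using j unfolding star_complex_def by blast
    next
      case False
      have "x \<in> star_facet n \<T> (Suc n)" if x: "x \<in> C" for x
      proof -
        obtain j T where jT: "x = vertex j T" "T \<in> \<T>"
          using vertices[OF x] by blast
        then have "j = Suc n" using False x by blast
        then show ?thesis
          using jT center_notin by (simp add: vertex_in_star_facet)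
      qed
      then have "C \<subseteq> star_facet n \<T> (Suc n)" by blast
      then show ?thesis unfolding star_complex_def by auto
    qed
  qed
  ultimately have "E \<subseteq> [\<Union>?K]\<^bsup>2\<^esup> \<and> ?K = {C. C \<subseteq> \<Union>?K \<and> clique C E}"
    by (intro conjI set_eqI iffI) simp_all
  then show ?thesis
    unfolding clique_complex_def using simplicial_star_complex by blast
qed

text \<open>A vertex that can be added to every face lies in every facet. So it is no private vertex,
  and the set that it comes from omits no \<open>i\<close>.\<close>

lemma cone_point_star_complex:
  "(\<exists>v. \<forall>A\<in>star_complex n \<T>. insert v A \<in> star_complex n \<T>) \<longleftrightarrow> {1..n} \<in> \<T>"
proof
  assume "\<exists>v. \<forall>A\<in>star_complex n \<T>. insert v A \<in> star_complex n \<T>"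
  then obtain v where v: "\<And>A. A \<in> star_complex n \<T> \<Longrightarrow> insert v A \<in> star_complex n \<T>" by blast
  have in_facet: "v \<in> star_facet n \<T> i" if i: "i \<in> {1..Suc n}" for i
  proof -
    have "insert v (star_facet n \<T> i) \<in> star_complex n \<T>"
      using v i unfolding star_complex_def by blast
    then obtain i' where i': "i' \<in> {1..Suc n}" "insert v (star_facet n \<T> i) \<subseteq> star_facet n \<T> i'"
      unfolding star_complex_def by blast
    then have "i = i'" using star_facet_subset i by blast
    then show ?thesis using i' by blast
  qed
  have "v \<in> star_facet n \<T> (Suc n)" using in_facet by simp
  then obtain j T where jT: "v = vertex j T" "T \<in> \<T>" using star_facetE by blast
  have j: "j = Suc n"
    using in_facet[of "Suc n"] jT by (simp add: vertex_in_star_facet split: if_splits)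
  have "i \<in> T" if "i \<in> {1..n}" for i
    using in_facet[of i] jT j that by (simp add: vertex_in_star_facet split: if_splits)
  then have "T = {1..n}" using subsets jT by blast
  then show "{1..n} \<in> \<T>" using jT by simp
next
  assume full: "{1..n} \<in> \<T>"
  have "vertex (Suc n) {1..n} \<in> star_facet n \<T> i" if "i \<in> {1..Suc n}" for i
    using that unfolding vertex_in_star_facet[OF full] by auto
  then have "insert (vertex (Suc n) {1..n}) A \<in> star_complex n \<T>" if "A \<in> star_complex n \<T>" for A
    using that unfolding star_complex_def by blast
  then show "\<exists>v. \<forall>A\<in>star_complex n \<T>. insert v A \<in> star_complex n \<T>" by blast
qed

text \<open>A facet contains exactly one vertex for each member \<open>T\<close> of the family, and the facets in \<open>I\<close>
  share a vertex for \<open>T\<close> if and only if they all pick the same one. So the intersection is counted by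
  a condition that depends on \<open>T\<close> only through \<open>T \<inter> I\<close>.\<close>

lemma card_Inter_star_facet:
  assumes "i0 \<in> I"
  shows "card (\<Inter>i\<in>I. star_facet n \<T> i) =
    card {T \<in> \<T>. \<forall>i\<in>I. (if i \<in> T then Suc n else i) = (if i0 \<in> T then Suc n else i0)}"
    (is "_ = card ?\<S>")
proof -
  let ?f = "\<lambda>T. vertex (if i0 \<in> T then Suc n else i0) T"
  have "(\<Inter>i\<in>I. star_facet n \<T> i) = ?f ` ?\<S>"
  proof (intro set_eqI iffI)
    fix x assume x: "x \<in> (\<Inter>i\<in>I. star_facet n \<T> i)"
    then have "x \<in> star_facet n \<T> i0" using assms by blast
    then obtain T where T: "T \<in> \<T>" "x = ?f T" unfolding star_facet_def by blast
    have "(if i \<in> T then Suc n else i) = (if i0 \<in> T then Suc n else i0)" if "i \<in> I" for i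
    proof -
      have "?f T \<in> star_facet n \<T> i" using x T(2) that by blast
      then show ?thesis unfolding vertex_in_star_facet[OF T(1)] by (rule sym)
    qed
    then show "x \<in> ?f ` ?\<S>" using T by blast
  next
    fix x assume "x \<in> ?f ` ?\<S>"
    then obtain T where T: "T \<in> \<T>" "x = ?f T"
      and same: "\<forall>i\<in>I. (if i \<in> T then Suc n else i) = (if i0 \<in> T then Suc n else i0)" by blast
    have "x \<in> star_facet n \<T> i" if "i \<in> I" for i
      unfolding T(2) vertex_in_star_facet[OF T(1)] by (rule same[rule_format, OF that, symmetric])
    then show "x \<in> (\<Inter>i\<in>I. star_facet n \<T> i)" by blast
  qed
  moreover have "inj_on ?f ?\<S>"
    using inj_on_vertices by (rule inj_on_subset) blast
  ultimately show ?thesis by (simp add: card_image)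
qed

end

lemma complex_iso_cone_point:
  assumes "complex_iso K L" "\<exists>v. \<forall>A\<in>K. insert v A \<in> K"
  shows "\<exists>w. \<forall>B\<in>L. insert w B \<in> L"
proof -
  obtain f where "bij_betw (image f) K L"
    using assms(1) unfolding complex_iso_def by blast
  then have L: "L = image f ` K" by (simp add: bij_betw_def)
  obtain v where v: "\<And>A. A \<in> K \<Longrightarrow> insert v A \<in> K" using assms(2) by blast
  have "insert (f v) B \<in> L" if "B \<in> L" for B
  proof -
    obtain A where A: "A \<in> K" "B = f ` A" using \<open>B \<in> L\<close> L by blast
    then have "insert (f v) B = f ` insert v A" by simp
    then show ?thesis using v[OF A(1)] unfolding L by (rule image_eqI)
  qed
  then show ?thesis by blast
qed

section \<open>Even and odd subsets\<close>

definition even_subsets :: "nat \<Rightarrow> nat set set" where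
  "even_subsets n = {T. T \<subseteq> {1..n} \<and> even (card T)}"

definition odd_subsets :: "nat \<Rightarrow> nat set set" where
  "odd_subsets n = {T. T \<subseteq> {1..n} \<and> odd (card T)}"

definition toggle :: "'a \<Rightarrow> 'a set \<Rightarrow> 'a set" where
  "toggle a T = (if a \<in> T then T - {a} else insert a T)"

lemma toggle_toggle: "toggle a (toggle a T) = T"
  by (auto simp: toggle_def)

lemma mem_toggle: "i \<noteq> a \<Longrightarrow> i \<in> toggle a T \<longleftrightarrow> i \<in> T"
  by (auto simp: toggle_def)

lemma even_card_toggle:
  assumes "finite T"
  shows "even (card (toggle a T)) \<longleftrightarrow> odd (card T)"
proof (cases "a \<in> T")
  case True
  with assms have "card T = Suc (card (T - {a}))"
    by (rule card.remove)
  then show ?thesis using True by (simp add: toggle_def)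
qed (use assms in \<open>simp add: toggle_def\<close>)

lemma toggle_even_odd_subsets:
  assumes "a \<in> {1..n}"
  shows "T \<in> even_subsets n \<Longrightarrow> toggle a T \<in> odd_subsets n"
    and "T \<in> odd_subsets n \<Longrightarrow> toggle a T \<in> even_subsets n"
proof -
  have *: "toggle a T \<subseteq> {1..n}" "finite T" if "T \<subseteq> {1..n}"
    using that assms finite_subset[of T "{1..n}"] by (auto simp: toggle_def)
  show "T \<in> even_subsets n \<Longrightarrow> toggle a T \<in> odd_subsets n"
    and "T \<in> odd_subsets n \<Longrightarrow> toggle a T \<in> even_subsets n"
    using * even_card_toggle[of T a] by (auto simp: even_subsets_def odd_subsets_def)
qed

lemma star_family_even_subsets: "star_family n (even_subsets n)"
proof
  fix i assume "i \<in> {1..n}"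
  have "{} \<in> even_subsets n" by (simp add: even_subsets_def)
  then show "\<exists>T\<in>even_subsets n. i \<notin> T" by blast
qed (auto simp: even_subsets_def)

lemma star_family_odd_subsets:
  assumes "n \<ge> 2"
  shows "star_family n (odd_subsets n)"
proof
  fix i assume "i \<in> {1..n}"
  define i' where "i' = (if i = 1 then 2 else 1 :: nat)"
  have "{i'} \<in> odd_subsets n" "i \<notin> {i'}"
    using assms by (auto simp: odd_subsets_def i'_def)
  then show "\<exists>T\<in>odd_subsets n. i \<notin> T" by blast
qed (auto simp: odd_subsets_def)

text \<open>Toggling an element outside \<open>I\<close> exchanges the two families and preserves all incidences with
  the facets in \<open>I\<close>.\<close>

lemma card_Inter_eq:
  assumes "n \<ge> 2" "I \<noteq> {}" "finite I" "card I < n"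
  shows "card (\<Inter>i\<in>I. star_facet n (even_subsets n) i) =
    card (\<Inter>i\<in>I. star_facet n (odd_subsets n) i)"
proof -
  obtain i0 where i0: "i0 \<in> I" using assms(2) by blast
  obtain a where a: "a \<in> {1..n}" "a \<notin> I"
    using card_mono[OF \<open>finite I\<close>, of "{1..n}"] assms(4) by fastforce
  define P where "P T \<longleftrightarrow> (\<forall>i\<in>I. (if i \<in> T then Suc n else i) = (if i0 \<in> T then Suc n else i0))" for T
  have mem: "i \<in> toggle a T \<longleftrightarrow> i \<in> T" if "i \<in> I" for i T
    using mem_toggle[of i a T] that a(2) by blast
  have P_toggle: "P (toggle a T) \<longleftrightarrow> P T" for T
    unfolding P_def using mem i0 by simp
  have "bij_betw (toggle a) {T \<in> even_subsets n. P T} {T \<in> odd_subsets n. P T}"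
    by (rule bij_betw_byWitness[where f' = "toggle a"])
      (use a(1) toggle_even_odd_subsets P_toggle in \<open>auto simp: toggle_toggle\<close>)
  then have "card {T \<in> even_subsets n. P T} = card {T \<in> odd_subsets n. P T}"
    by (rule bij_betw_same_card)
  then show ?thesis
    unfolding P_def
      star_family.card_Inter_star_facet[OF star_family_even_subsets i0]
      star_family.card_Inter_star_facet[OF star_family_odd_subsets[OF assms(1)] i0] .
qed

lemma intersection_data_eq:
  assumes "n \<ge> 2" "1 \<le> j" "j < n"
  shows "intersection_data q (star_facet n (even_subsets n)) j =
    intersection_data q (star_facet n (odd_subsets n)) j"
  unfolding intersection_data_def
proof (rule restrict_ext)
  fix I assume "I \<in> {I. I \<subseteq> {1..q} \<and> card I = j}"
  then have "I \<noteq> {}" "finite I" "card I < n"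
    using assms finite_subset[of I "{1..q}"] by auto
  then show "card (\<Inter>i\<in>I. star_facet n (even_subsets n) i) =
      card (\<Inter>i\<in>I. star_facet n (odd_subsets n) i)"
    using card_Inter_eq assms(1) by blast
qed

theorem proposition3p2:
  fixes k :: nat
  assumes "k \<ge> 1"
  shows "\<exists>(q::nat) (K :: nat set set) (K' :: nat set set) (F :: nat \<Rightarrow> nat set) (F' :: nat \<Rightarrow> nat set).
    q \<ge> k \<and>
    pure_complex K \<and> clique_complex K \<and> pure_complex K' \<and> clique_complex K' \<and>
    \<not> complex_iso K K' \<and>
    facet_labeling K q F \<and> facet_labeling K' q F' \<and>
    (\<forall>j. 1 \<le> j \<and> j \<le> k \<longrightarrow> intersection_data q F j = intersection_data q F' j)"
proof -
  define n where "n = 2 * k"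
  have n: "n \<ge> 2" "k < n" "even n" using assms by (auto simp: n_def)
  interpret even: star_family n "even_subsets n" by (rule star_family_even_subsets)
  interpret odd: star_family n "odd_subsets n" by (rule star_family_odd_subsets) (rule n)
  have "{1..n} \<in> even_subsets n" "{1..n} \<notin> odd_subsets n"
    using n by (auto simp: even_subsets_def odd_subsets_def)
  then have not_iso: "\<not> complex_iso (star_complex n (even_subsets n)) (star_complex n (odd_subsets n))"
    using complex_iso_cone_point even.cone_point_star_complex odd.cone_point_star_complex by metis
  show ?thesis
  proof (intro exI conjI)
    show "k \<le> Suc n" using n by simp
    show "\<forall>j. 1 \<le> j \<and> j \<le> k \<longrightarrow> intersection_data (Suc n) (star_facet n (even_subsets n)) j =
        intersection_data (Suc n) (star_facet n (odd_subsets n)) j"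
      using intersection_data_eq n by simp
  qed (rule not_iso even.pure_star_complex even.clique_star_complex even.facet_labeling_star
      odd.pure_star_complex odd.clique_star_complex odd.facet_labeling_star)+
qed

end
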